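(* Let $R$ be the root system of type $G_2$, let $q\in\mathbb{C}^\times$ be such that $q^2$ is not a primitive $\ell$-th root of unity for any $\ell\leq6$, and let $t\in T$ with $Z(t)\cup P(t)\neq\emptyset$. Then $t$ is in the same $W_0$-orbit as one of the following weights: $$t_{1,1},\ t_{1,-1},\ t_{\zeta,1},\ t_{1,q^2},\ t_{1,\pm q},\ t_{q^2,1},\ t_{\pm q,1},\ t_{r,1},\ t_{q^2,-q^{-2}},\ t_{\zeta,q^2},\ t_{q^2,q^2},$$ where $\zeta$ is a primitive third root of unity and $r$ is a third root of $q^2$ (any choices allowed); or one of $t_{1,z}$ with $z\in\mathbb{C}^\times$, $z\neq\pm1,q^{\pm2},\pm q^{\pm1}$; $t_{z,1}$ with $z\in\mathbb{C}^\times$, $z\neq\pm1,q^{\pm2},\pm q^{\pm1}$, $z^3\neq1$, $z^3\neq q^{\pm2}$; $t_{q^2,z}$ with $z\in\mathbb{C}^\times$, $\{1,q^2,q^{-2}\}\cap\{z,q^2z,q^4z,q^6z,q^6z^2\}=\emptyset$; $t_{z,q^2}$ with $z\in\mathbb{C}^\times$, $\{1,q^2,q^{-2}\}\cap\{z,q^2z,q^2z^2,q^2z^3,q^4z^3\}=\emptyset$.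
   Context: The type $G_2$ root system has simple roots $\alpha_1,\alpha_2$ with $\langle\alpha_1,\alpha_2^\vee\rangle=-1$, $\langle\alpha_2,\alpha_1^\vee\rangle=-3$, positive roots $R^+=\{\alpha_1,\alpha_2,\alpha_1+\alpha_2,2\alpha_1+\alpha_2,3\alpha_1+\alpha_2,3\alpha_1+2\alpha_2\}$, and Weyl group $W_0=\langle s_1,s_2\rangle$, $s_i\lambda=\lambda-\langle\lambda,\alpha_i^\vee\rangle\alpha_i$ (dihedral of order $12$). $P=\mathbb{Z}\alpha_1+\mathbb{Z}\alpha_2$ is the weight lattice (equal to the root lattice), $X=\{X^\lambda\mid\lambda\in P\}$ with $X^\lambda X^\mu=X^{\lambda+\mu}$, and $T=\mathrm{Hom}(X,\mathbb{C}^\times)$, with $W_0$-action $(wt)(X^\lambda)=t(X^{w^{-1}\lambda})$. For $z,w\in\mathbb{C}^\times$, $t_{z,w}\in T$ is defined by $t_{z,w}(X^{\alpha_1})=z$, $t_{z,w}(X^{\alpha_2})=w$. $Z(t)=\{\alpha\in R^+\mid t(X^\alpha)=1\}$ and $P(t)=\{\alpha\in R^+\mid t(X^\alpha)\in\{q^2,q^{-2}\}\}$. *)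

theory Defs
  imports Complex_Main "HOL-Library.Product_Plus" "HOL-Algebra.Algebra"
begin

text \<open>The weight lattice \<open>P = \<int>\<alpha>\<^sub>1 + \<int>\<alpha>\<^sub>2\<close>: the pair \<open>(a, b)\<close> stands for \<open>a\<alpha>\<^sub>1 + b\<alpha>\<^sub>2\<close>.\<close>

type_synonym weight = "int \<times> int"

definition zscale :: "int \<Rightarrow> weight \<Rightarrow> weight" where
  "zscale c l = (c * fst l, c * snd l)"

definition \<alpha>1 :: weight where "\<alpha>1 = (1, 0)"
definition \<alpha>2 :: weight where "\<alpha>2 = (0, 1)"

text \<open>\<open>pair_i l = \<langle>l, \<alpha>\<^sub>i\<^sup>\<or>\<rangle>\<close>, the linear extension of the Cartan integers
  \<open>\<langle>\<alpha>\<^sub>1, \<alpha>\<^sub>2\<^sup>\<or>\<rangle> = -1\<close>, \<open>\<langle>\<alpha>\<^sub>2, \<alpha>\<^sub>1\<^sup>\<or>\<rangle> = -3\<close>. So \<open>\<alpha>\<^sub>1\<close> is the short simple root.\<close>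

definition pair1 :: "weight \<Rightarrow> int" where "pair1 l = 2 * fst l - 3 * snd l"
definition pair2 :: "weight \<Rightarrow> int" where "pair2 l = - fst l + 2 * snd l"

definition s1 :: "weight \<Rightarrow> weight" where "s1 l = l - zscale (pair1 l) \<alpha>1"
definition s2 :: "weight \<Rightarrow> weight" where "s2 l = l - zscale (pair2 l) \<alpha>2"

definition Rpos :: "weight set" where
  "Rpos = {\<alpha>1, \<alpha>2, \<alpha>1 + \<alpha>2, zscale 2 \<alpha>1 + \<alpha>2, zscale 3 \<alpha>1 + \<alpha>2, zscale 3 \<alpha>1 + zscale 2 \<alpha>2}"

definition W0 :: "(weight \<Rightarrow> weight) set" where
  "W0 = generate (BijGroup UNIV) {s1, s2}"

text \<open>The group \<open>X = {X\<^sup>\<lambda> | \<lambda> \<in> P}\<close>, with \<open>X\<^sup>\<lambda>\<close> represented by its exponent \<open>\<lambda>\<close>;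
  thus \<open>t(X\<^sup>\<lambda>)\<close> is written \<open>t \<lambda>\<close>.\<close>

definition Xgrp :: "weight monoid" where
  "Xgrp = \<lparr>carrier = UNIV, monoid.mult = (+), one = 0\<rparr>"

definition Cstar :: "complex monoid" where
  "Cstar = \<lparr>carrier = UNIV - {0}, monoid.mult = (*), one = 1\<rparr>"

definition T :: "(weight \<Rightarrow> complex) set" where
  "T = hom Xgrp Cstar"

definition W_act :: "(weight \<Rightarrow> weight) \<Rightarrow> (weight \<Rightarrow> complex) \<Rightarrow> weight \<Rightarrow> complex" where
  "W_act w t = (\<lambda>l. t (inv_into UNIV w l))"

definition W_orbit :: "(weight \<Rightarrow> complex) \<Rightarrow> (weight \<Rightarrow> complex) set" where
  "W_orbit t = {W_act w t | w. w \<in> W0}"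

text \<open>For nonzero \<open>z\<close>, \<open>w\<close> this is the unique character with value \<open>z\<close> at \<open>\<alpha>\<^sub>1\<close> and
  \<open>w\<close> at \<open>\<alpha>\<^sub>2\<close>.\<close>

definition tw :: "complex \<Rightarrow> complex \<Rightarrow> weight \<Rightarrow> complex" where
  "tw z w = (\<lambda>l. z powi fst l * w powi snd l)"

definition Zset :: "(weight \<Rightarrow> complex) \<Rightarrow> weight set" where
  "Zset t = {\<alpha> \<in> Rpos. t \<alpha> = 1}"

definition Pset :: "complex \<Rightarrow> (weight \<Rightarrow> complex) \<Rightarrow> weight set" where
  "Pset q t = {\<alpha> \<in> Rpos. t \<alpha> \<in> {q powi 2, q powi (-2)}}"

definition primitive_root_of_unity :: "nat \<Rightarrow> complex \<Rightarrow> bool" where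
  "primitive_root_of_unity n z \<longleftrightarrow> n > 0 \<and> z ^ n = 1 \<and> (\<forall>k. 0 < k \<and> k < n \<longrightarrow> z ^ k \<noteq> 1)"

end

theory Submission
  imports Defs
begin

text \<open>A character is \<open>t\<^bsub>z,w\<^esub>\<close> for its values \<open>z, w\<close> at the two simple roots, and every root of
  \<open>G\<^sub>2\<close> is \<open>W\<^sub>0\<close>-conjugate to \<open>\<alpha>\<^sub>1\<close> (if short) or \<open>\<alpha>\<^sub>2\<close> (if long). The simple reflections
  act on the pairs \<open>(z, w)\<close> by \<open>(z\<^sup>-\<^sup>1, z\<^sup>3w)\<close> and \<open>(zw, w\<^sup>-\<^sup>1)\<close>, and the longest element of \<open>W\<^sub>0\<close>
  inverts both coordinates. So a root in \<open>Z(t)\<close> allows us to assume \<open>z = 1\<close> or \<open>w = 1\<close>, and a root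
  in \<open>P(t)\<close> allows us to assume \<open>z = q\<^sup>2\<close> or \<open>w = q\<^sup>2\<close>, the value \<open>q\<^sup>-\<^sup>2\<close> being removed by inversion.

  If \<open>Z(t)\<close> is not empty, the free coordinate is, up to inversion, either generic or one of the
  listed special values; the one exception \<open>t\<^bsub>-1,1\<^esub>\<close> is conjugate to \<open>t\<^bsub>1,-1\<^esub>\<close>
  (\<open>value_one_represented\<close>). If \<open>t\<^bsub>q\<^sup>2,z\<^esub>\<close> is not generic, then a second positive root has value
  \<open>1\<close>, which is the case just treated, or \<open>q\<^bsup>\<plusminus>2\<^esup>\<close>. Each equation of the latter kind either
  forces some other root to have value \<open>1\<close>, or else leaves only \<open>t\<^bsub>q\<^sup>2,q\<^sup>2\<^esub>\<close>, \<open>t\<^bsub>q\<^sup>2,-q\<^sup>-\<^sup>2\<^esub>\<close> and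
  their conjugates (\<open>short_root_pole_represented\<close>). For \<open>t\<^bsub>z,q\<^sup>2\<^esub>\<close> a short root in \<open>P(t)\<close> leads back
  to the previous case, so only the equations for long roots remain; they make \<open>z\<close> or \<open>q\<^sup>2z\<close> a cube
  root of unity and give \<open>t\<^bsub>\<zeta>,q\<^sup>2\<^esub>\<close> (\<open>long_root_pole_represented\<close>).\<close>

section \<open>The Weyl group action in coordinates\<close>

lemma s1_involution: "s1 \<circ> s1 = id"
  by (auto simp: fun_eq_iff s1_def pair1_def zscale_def \<alpha>1_def)

lemma s2_involution: "s2 \<circ> s2 = id"
  by (auto simp: fun_eq_iff s2_def pair2_def zscale_def \<alpha>2_def)

lemma W0_imp_bij: "w \<in> W0 \<Longrightarrow> bij w"
proof -
  assume "w \<in> W0"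
  moreover have "{s1, s2} \<subseteq> carrier (BijGroup UNIV)"
    using o_bij[OF s1_involution s1_involution] o_bij[OF s2_involution s2_involution]
    by (auto simp: BijGroup_def Bij_def)
  ultimately have "w \<in> carrier (BijGroup UNIV)"
    unfolding W0_def using group.generate_in_carrier[OF group_BijGroup] by blast
  then show "bij w" by (simp add: BijGroup_def Bij_def)
qed

lemma W0_comp:
  assumes "s \<in> {s1, s2}" "w \<in> W0"
  shows "s \<circ> w \<in> W0"
proof -
  have s: "s \<in> W0" using assms(1) unfolding W0_def by (rule generate.incl)
  have "s \<otimes>\<^bsub>BijGroup UNIV\<^esub> w \<in> W0"
    using s assms(2) unfolding W0_def by (rule generate.eng)
  moreover have "s \<otimes>\<^bsub>BijGroup UNIV\<^esub> w = s \<circ> w"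
    using W0_imp_bij[OF s] W0_imp_bij[OF assms(2)]
    by (auto simp: BijGroup_def Bij_def compose_def fun_eq_iff)
  ultimately show ?thesis by simp
qed

lemma W_orbit_refl: "u \<in> W_orbit u"
proof -
  have "\<one>\<^bsub>BijGroup UNIV\<^esub> \<in> W0" unfolding W0_def by (rule generate.one)
  then have "id \<in> W0" by (simp add: BijGroup_def restrict_def id_def)
  moreover have "W_act id u = u" by (simp add: W_act_def)
  ultimately show ?thesis unfolding W_orbit_def by force
qed

text \<open>Reflections equal their inverses, so acting by one is precomposition with it.\<close>

lemma W_orbit_precompose:
  assumes "s \<in> {s1, s2}" "t \<in> W_orbit u"
  shows "t \<circ> s \<in> W_orbit u"
proof -
  obtain w where w: "w \<in> W0" "t = W_act w u" using assms(2) by (auto simp: W_orbit_def)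
  have ss: "s \<circ> s = id" using assms(1) s1_involution s2_involution by auto
  have "inv_into UNIV (s \<circ> w) = inv_into UNIV w \<circ> s"
    using o_inv_distrib[OF o_bij[OF ss ss] W0_imp_bij[OF w(1)]] inv_unique_comp[OF ss ss] by simp
  then have "t \<circ> s = W_act (s \<circ> w) u"
    by (simp add: w(2) W_act_def comp_def)
  then show ?thesis using W0_comp[OF assms(1) w(1)] by (auto simp: W_orbit_def)
qed

lemma tw_comp_s1:
  assumes "z \<noteq> 0" "w \<noteq> 0"
  shows "tw z w \<circ> s1 = tw (1 / z) (z ^ 3 * w)"
proof
  fix l :: weight
  have "(z ^ 3 * w) powi snd l = z powi (3 * snd l) * w powi snd l"
    by (simp add: power_int_mult_distrib power_int_mult)
  moreover have "(1 / z) powi fst l = z powi (- fst l)"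
    by (simp add: power_int_minus divide_inverse power_int_inverse)
  moreover have "z powi (3 * snd l - fst l) = z powi (- fst l) * z powi (3 * snd l)"
    using assms by (simp flip: power_int_add)
  ultimately show "(tw z w \<circ> s1) l = tw (1 / z) (z ^ 3 * w) l"
    by (simp add: tw_def s1_def pair1_def zscale_def \<alpha>1_def mult.assoc)
qed

lemma tw_comp_s2:
  assumes "z \<noteq> 0" "w \<noteq> 0"
  shows "tw z w \<circ> s2 = tw (z * w) (1 / w)"
proof
  fix l :: weight
  have "(1 / w) powi snd l = w powi (- snd l)"
    by (simp add: power_int_minus divide_inverse power_int_inverse)
  moreover have "w powi (fst l - snd l) = w powi fst l * w powi (- snd l)"
    using assms by (simp flip: power_int_add)
  ultimately show "(tw z w \<circ> s2) l = tw (z * w) (1 / w) l"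
    by (simp add: tw_def s2_def pair2_def zscale_def \<alpha>2_def power_int_mult_distrib mult.assoc)
qed

text \<open>Characters are group homomorphisms on the free abelian group \<open>P\<close> of rank two, hence
  determined by the images of a basis.\<close>

lemma T_eq_tw:
  assumes "t \<in> T"
  shows "t \<alpha>1 \<noteq> 0" "t \<alpha>2 \<noteq> 0" "t = tw (t \<alpha>1) (t \<alpha>2)"
proof -
  have nz: "t l \<noteq> 0" for l using assms by (auto simp: T_def hom_def Xgrp_def Cstar_def)
  have add: "t (k + l) = t k * t l" for k l
    using assms by (simp add: T_def hom_def Xgrp_def Cstar_def del: split_paired_All)
  have t0: "t 0 = 1" using add[of 0 0] nz[of 0] by simp
  have pow: "t (zscale c l) = t l powi c" for c l
  proof (induction c rule: int_induct[where k = 0])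
    case base then show ?case using t0 by (simp add: zscale_def zero_prod_def)
  next
    case (step1 i)
    have "zscale (i + 1) l = zscale i l + l" by (simp add: zscale_def prod_eq_iff algebra_simps)
    then show ?case using step1 nz by (simp add: add power_int_add)
  next
    case (step2 i)
    have "zscale i l = zscale (i - 1) l + l" by (simp add: zscale_def prod_eq_iff algebra_simps)
    then have "t l powi (i - 1) * t l = t (zscale (i - 1) l) * t l"
      using step2 nz[of l] by (simp add: add power_int_diff)
    then show ?case using nz by simp
  qed
  have "l = zscale (fst l) \<alpha>1 + zscale (snd l) \<alpha>2" for l
    by (simp add: zscale_def \<alpha>1_def \<alpha>2_def)
  then have "t l = t \<alpha>1 powi fst l * t \<alpha>2 powi snd l" for l
    by (metis add pow)
  then show "t = tw (t \<alpha>1) (t \<alpha>2)" unfolding tw_def by (rule ext)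
  show "t \<alpha>1 \<noteq> 0" "t \<alpha>2 \<noteq> 0" by (rule nz)+
qed

definition root_values :: "complex \<Rightarrow> complex \<Rightarrow> complex set" where
  "root_values z w = {z, w, z * w, z ^ 2 * w, z ^ 3 * w, z ^ 3 * w ^ 2}"

lemma tw_image_Rpos: "tw z w ` Rpos = root_values z w"
  by (simp add: Rpos_def root_values_def tw_def \<alpha>1_def \<alpha>2_def zscale_def)

section \<open>Orbit representatives\<close>

definition representatives :: "complex \<Rightarrow> complex \<Rightarrow> (weight \<Rightarrow> complex) set" where
  "representatives q \<zeta> = {u.
    (u \<in> {tw 1 1, tw 1 (-1), tw \<zeta> 1, tw 1 (q ^ 2), tw 1 q, tw 1 (- q),
           tw (q ^ 2) 1, tw q 1, tw (- q) 1,
           tw (q ^ 2) (- (q powi (-2))), tw \<zeta> (q ^ 2), tw (q ^ 2) (q ^ 2)}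
     \<or> (\<exists>r. r ^ 3 = q ^ 2 \<and> u = tw r 1)
     \<or> (\<exists>z. z \<noteq> 0 \<and> z \<notin> {1, -1, q ^ 2, q powi (-2), q, - q, q powi (-1), - (q powi (-1))}
            \<and> u = tw 1 z)
     \<or> (\<exists>z. z \<noteq> 0 \<and> z \<notin> {1, -1, q ^ 2, q powi (-2), q, - q, q powi (-1), - (q powi (-1))}
            \<and> z ^ 3 \<noteq> 1 \<and> z ^ 3 \<notin> {q ^ 2, q powi (-2)}
            \<and> u = tw z 1)
     \<or> (\<exists>z. z \<noteq> 0
            \<and> {1, q ^ 2, q powi (-2)} \<inter> {z, q ^ 2 * z, q ^ 4 * z, q ^ 6 * z, q ^ 6 * z ^ 2} = {}
            \<and> u = tw (q ^ 2) z)
     \<or> (\<exists>z. z \<noteq> 0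
            \<and> {1, q ^ 2, q powi (-2)} \<inter>
              {z, q ^ 2 * z, q ^ 2 * z ^ 2, q ^ 2 * z ^ 3, q ^ 4 * z ^ 3} = {}
            \<and> u = tw z (q ^ 2)))}"

definition represented :: "complex \<Rightarrow> complex \<Rightarrow> complex \<Rightarrow> complex \<Rightarrow> bool" where
  "represented q \<zeta> z w \<longleftrightarrow> (\<exists>u\<in>representatives q \<zeta>. tw z w \<in> W_orbit u)"

lemma represented_refl: "tw z w \<in> representatives q \<zeta> \<Longrightarrow> represented q \<zeta> z w"
  using W_orbit_refl unfolding represented_def by blast

text \<open>These two rules are used backwards: they replace the character to be represented by its image
  under a simple reflection.\<close>

lemma represented_s1:
  assumes "z \<noteq> 0" "w \<noteq> 0" "represented q \<zeta> (1 / z) (z ^ 3 * w)"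
  shows "represented q \<zeta> z w"
proof -
  have "tw (1 / z) (z ^ 3 * w) \<circ> s1 = tw z w"
    using assms tw_comp_s1[of "1 / z" "z ^ 3 * w"] by (simp add: field_simps)
  then show ?thesis using assms(3) W_orbit_precompose[of s1] unfolding represented_def by fastforce
qed

lemma represented_s2:
  assumes "z \<noteq> 0" "w \<noteq> 0" "represented q \<zeta> (z * w) (1 / w)"
  shows "represented q \<zeta> z w"
proof -
  have "tw (z * w) (1 / w) \<circ> s2 = tw z w"
    using assms tw_comp_s2[of "z * w" "1 / w"] by simp
  then show ?thesis using assms(3) W_orbit_precompose[of s2] unfolding represented_def by fastforce
qed

text \<open>The Weyl group contains \<open>-1 = (s\<^sub>2s\<^sub>1)\<^sup>3\<close>.\<close>

lemma represented_inverse: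
  assumes "z \<noteq> 0" "w \<noteq> 0" "represented q \<zeta> (1 / z) (1 / w)"
  shows "represented q \<zeta> z w"
proof -
  have 1: "represented q \<zeta> (1 / z * (z ^ 3 * w)) (1 / (z ^ 3 * w)) \<Longrightarrow> represented q \<zeta> z w"
    if "z \<noteq> 0" "w \<noteq> 0" for z w
    using that by (intro represented_s1[of z w] represented_s2[of "1 / z"]) auto
  have step: "represented q \<zeta> (z ^ 2 * w) (1 / (z ^ 3 * w)) \<Longrightarrow> represented q \<zeta> z w"
    if "z \<noteq> 0" "w \<noteq> 0" for z w
    using 1[OF that] that by (simp add: field_simps power2_eq_square power3_eq_cube)
  show ?thesis
  proof (rule step, fact, fact, rule step)
    have "(z\<^sup>2 * w)\<^sup>2 * (1 / (z ^ 3 * w)) = z * w"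
      "1 / ((z\<^sup>2 * w) ^ 3 * (1 / (z ^ 3 * w))) = 1 / (z ^ 3 * w ^ 2)"
      using assms by (simp_all add: field_simps eval_nat_numeral)
    moreover have "represented q \<zeta> (z * w) (1 / (z ^ 3 * w ^ 2))"
    proof (rule step)
      have "(z * w)\<^sup>2 * (1 / (z ^ 3 * w\<^sup>2)) = 1 / z" "1 / ((z * w) ^ 3 * (1 / (z ^ 3 * w\<^sup>2))) = 1 / w"
        using assms by (simp_all add: field_simps eval_nat_numeral)
      then show "represented q \<zeta> ((z * w)\<^sup>2 * (1 / (z ^ 3 * w\<^sup>2)))
          (1 / ((z * w) ^ 3 * (1 / (z ^ 3 * w\<^sup>2))))"
        using assms(3) by simp
    qed (use assms in auto)
    ultimately show "represented q \<zeta> ((z\<^sup>2 * w)\<^sup>2 * (1 / (z ^ 3 * w)))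
        (1 / ((z\<^sup>2 * w) ^ 3 * (1 / (z ^ 3 * w))))" by simp
  qed (use assms in auto)
qed

text \<open>\<open>W\<^sub>0\<close> is transitive on the roots of each length: to represent every \<open>t\<close> that takes the value
  \<open>v\<close> at a positive root, it suffices to treat those that take it at a simple root.\<close>

lemma represented_short_root:
  assumes "z \<noteq> 0" "w \<noteq> 0" "v \<in> {z, z * w, z ^ 2 * w}"
    and "\<And>y. y \<noteq> 0 \<Longrightarrow> represented q \<zeta> v y"
  shows "represented q \<zeta> z w"
proof -
  consider "v = z" | "v = z * w" | "v = z ^ 2 * w" using assms(3) by auto
  then show ?thesis
  proof cases
    case 1 then show ?thesis using assms by simp
  next
    case 2 then show ?thesis using assms by (intro represented_s2[of z]) auto
  next
    case 3
    have "1 / z * (z ^ 3 * w) = v"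
      using 3 assms(1) by (simp add: field_simps power2_eq_square power3_eq_cube)
    then show ?thesis
      using assms by (intro represented_s1[of z] represented_s2[of "1 / z"]) auto
  qed
qed

lemma represented_long_root:
  assumes "z \<noteq> 0" "w \<noteq> 0" "v \<in> {w, z ^ 3 * w, z ^ 3 * w ^ 2}"
    and "\<And>x. x \<noteq> 0 \<Longrightarrow> represented q \<zeta> x v"
  shows "represented q \<zeta> z w"
proof -
  consider "v = w" | "v = z ^ 3 * w" | "v = z ^ 3 * w ^ 2" using assms(3) by auto
  then show ?thesis
  proof cases
    case 1 then show ?thesis using assms by simp
  next
    case 2 then show ?thesis using assms by (intro represented_s1[of z]) auto
  next
    case 3
    have "(z * w) ^ 3 * (1 / w) = v"
      using 3 assms(2) by (simp add: field_simps power2_eq_square power3_eq_cube)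
    then show ?thesis
      using assms by (intro represented_s2[of z] represented_s1[of "z * w"]) auto
  qed
qed

section \<open>Characters with value one at some root\<close>

lemma cube_eq_one_cases:
  assumes "primitive_root_of_unity 3 \<zeta>" "z ^ 3 = 1"
  shows "z = 1 \<or> z = \<zeta> \<or> z = 1 / \<zeta>"
proof -
  have \<zeta>3: "\<zeta> ^ 3 = 1" and "\<zeta> ^ 1 \<noteq> 1"
    using assms(1) unfolding primitive_root_of_unity_def by auto
  then have "\<zeta> \<noteq> 1" "\<zeta> \<noteq> 0" by auto
  have "(\<zeta> - 1) * (\<zeta>\<^sup>2 + \<zeta> + 1) = 0"
    using \<zeta>3 by (simp add: algebra_simps power2_eq_square power3_eq_cube)
  then have "\<zeta>\<^sup>2 + \<zeta> + 1 = 0" using \<open>\<zeta> \<noteq> 1\<close> by simp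
  then have sum: "\<zeta> + \<zeta>\<^sup>2 = -1" by (simp add: eq_neg_iff_add_eq_0 ac_simps)
  have "(z - \<zeta>) * (z - \<zeta>\<^sup>2) = z\<^sup>2 - z * (\<zeta> + \<zeta>\<^sup>2) + \<zeta> ^ 3"
    by (simp add: algebra_simps eval_nat_numeral)
  also have "\<dots> = z\<^sup>2 + z + 1" by (simp add: sum \<zeta>3)
  finally have "(z - 1) * ((z - \<zeta>) * (z - \<zeta>\<^sup>2)) = z ^ 3 - 1"
    by (simp add: algebra_simps eval_nat_numeral)
  moreover have "\<zeta>\<^sup>2 = 1 / \<zeta>"
    using \<zeta>3 \<open>\<zeta> \<noteq> 0\<close> by (simp add: field_simps power2_eq_square power3_eq_cube)
  ultimately show ?thesis using assms(2) by auto
qed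

lemma short_root_one_represented:
  assumes "q \<noteq> 0" "z \<noteq> 0"
  shows "represented q \<zeta> 1 z"
proof (cases "z \<in> {1, -1, q\<^sup>2, q, - q} \<or> z \<notin> {1 / q\<^sup>2, 1 / q, - (1 / q)}")
  case True
  show ?thesis
    by (rule represented_refl)
      (use True assms in \<open>auto simp: representatives_def power_int_minus divide_inverse\<close>)
next
  case False
  show ?thesis
  proof (rule represented_inverse)
    show "represented q \<zeta> (1 / 1) (1 / z)"
      by (rule represented_refl) (use False assms in \<open>auto simp: representatives_def\<close>)
  qed (use assms in auto)
qed

lemma long_root_one_represented:
  assumes "q \<noteq> 0" "z \<noteq> 0" "primitive_root_of_unity 3 \<zeta>"
  shows "represented q \<zeta> z 1"
proof -
  have third: "z \<in> {1, \<zeta>, 1 / \<zeta>}" if "z ^ 3 = 1"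
    using cube_eq_one_cases[OF assms(3) that] by auto
  have *: "tw y 1 \<in> representatives q \<zeta>"
    if "y \<in> {1, \<zeta>, q\<^sup>2, q, - q} \<or> y ^ 3 = q\<^sup>2" for y
    using that by (auto simp: representatives_def)
  consider "z = -1" | "z \<in> {1, \<zeta>, q\<^sup>2, q, - q} \<or> z ^ 3 = q\<^sup>2"
    | "z \<in> {1 / \<zeta>, 1 / q\<^sup>2, 1 / q, - (1 / q)} \<or> z ^ 3 = 1 / q\<^sup>2"
    | "z \<notin> {1, -1, q\<^sup>2, 1 / q\<^sup>2, q, - q, 1 / q, - (1 / q)}" "z ^ 3 \<noteq> 1" "z ^ 3 \<noteq> q\<^sup>2" "z ^ 3 \<noteq> 1 / q\<^sup>2"
    using third by blast
  then show ?thesis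
  proof cases
    case 1
    \<comment> \<open>This character takes the value \<open>1\<close> at the short root \<open>2\<alpha>\<^sub>1 + \<alpha>\<^sub>2\<close>.\<close>
    show ?thesis
      by (rule represented_short_root[where v = 1])
        (use 1 assms short_root_one_represented in auto)
  next
    case 2 then show ?thesis using * by (intro represented_refl) auto
  next
    case 3
    then have "1 / z \<in> {1, \<zeta>, q\<^sup>2, q, - q} \<or> (1 / z) ^ 3 = q\<^sup>2"
      by (auto simp: power_one_over)
    then have "represented q \<zeta> (1 / z) (1 / 1)"
      using *[of "1 / z"] by (intro represented_refl) simp
    then show ?thesis using assms by (intro represented_inverse[of z]) auto
  next
    case 4
    have powi: "q powi (-2) = 1 / q\<^sup>2" "q powi (-1) = 1 / q"
      by (simp_all add: power_int_minus divide_inverse)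
    have "tw z 1 \<in> representatives q \<zeta>"
      using 4 assms(2) unfolding representatives_def powi by blast
    then show ?thesis by (rule represented_refl)
  qed
qed

lemma value_one_represented:
  assumes "q \<noteq> 0" "primitive_root_of_unity 3 \<zeta>" "z \<noteq> 0" "w \<noteq> 0" "1 \<in> root_values z w"
  shows "represented q \<zeta> z w"
proof -
  consider "1 \<in> {z, z * w, z ^ 2 * w}" | "1 \<in> {w, z ^ 3 * w, z ^ 3 * w ^ 2}"
    using assms(5) unfolding root_values_def by blast
  then show ?thesis
    using represented_short_root[OF assms(3,4) _ short_root_one_represented[OF assms(1)]]
      represented_long_root[OF assms(3,4) _ long_root_one_represented[OF assms(1) _ assms(2)]]
    by cases auto
qed

section \<open>Characters with value \<open>q\<^sup>2\<close> or its inverse at some root\<close>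

lemma short_root_pole_represented:
  assumes "q \<noteq> 0" "primitive_root_of_unity 3 \<zeta>" "z \<noteq> 0"
  shows "represented q \<zeta> (q\<^sup>2) z"
proof -
  define Q where "Q = q\<^sup>2"
  have Q: "Q \<noteq> 0" using assms(1) by (simp add: Q_def)
  have pows: "q ^ 4 = Q ^ 2" "q ^ 6 = Q ^ 3" by (simp_all add: Q_def flip: power_mult)
  have powi: "q powi (-2) = 1 / Q" by (simp add: Q_def power_int_minus divide_inverse)
  have regular: "represented q \<zeta> Q Q" "represented q \<zeta> Q (- (1 / Q))"
    by (rule represented_refl; simp add: representatives_def powi flip: Q_def)+
  have "represented q \<zeta> Q z"
  proof (cases "1 \<in> root_values Q z")
    case True then show ?thesis using value_one_represented assms Q by blast
  next
    case False
    then have ne: "z \<noteq> 1" "Q * z \<noteq> 1" "Q ^ 2 * z \<noteq> 1" "Q ^ 3 * z \<noteq> 1" "Q ^ 3 * z ^ 2 \<noteq> 1"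
      by (auto simp: root_values_def)
    consider (generic) "{1, Q, 1 / Q} \<inter> {z, Q * z, Q ^ 2 * z, Q ^ 3 * z, Q ^ 3 * z ^ 2} = {}"
      | (special) "\<exists>y\<in>{z, Q * z, Q ^ 2 * z, Q ^ 3 * z, Q ^ 3 * z ^ 2}. y = Q \<or> y * Q = 1"
      using ne Q by (auto simp: eq_divide_eq)
    then show ?thesis
    proof cases
      case generic
      then have "tw Q z \<in> representatives q \<zeta>"
        using assms(3) unfolding representatives_def pows powi Q_def[symmetric] by blast
      then show ?thesis by (rule represented_refl)
    next
      case special
      \<comment> \<open>Each of the other equations makes the value \<open>1\<close> at a root that differs by \<open>\<plusminus>\<alpha>\<^sub>1\<close>.\<close>
      then consider "z = Q" | "Q ^ 4 * z = 1" | "Q ^ 2 * z ^ 2 = 1" | "Q ^ 4 * z ^ 2 = 1"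
        using ne Q by (auto simp: eval_nat_numeral ac_simps)
      then show ?thesis
      proof cases
        case 1 then show ?thesis using regular by simp
      next
        case 2
        then have "Q ^ 3 * z = 1 / Q" using Q by (simp add: field_simps eval_nat_numeral)
        then show ?thesis using regular Q assms
          by (intro represented_s1[of Q] represented_inverse[of "1 / Q"]) auto
      next
        case 3
        then have "(Q * z - 1) * (Q * z + 1) = 0" by (simp add: algebra_simps power2_eq_square)
        then have "Q * z = -1" using ne by (simp add: eq_neg_iff_add_eq_0)
        then have "z = - (1 / Q)" using Q by (simp add: field_simps)
        then show ?thesis using regular by simp
      next
        case 4
        then have "(Q ^ 2 * z - 1) * (Q ^ 2 * z + 1) = 0"
          by (simp add: algebra_simps eval_nat_numeral)
        then have "Q ^ 2 * z = -1" using ne by (simp add: eq_neg_iff_add_eq_0)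
        then have "Q ^ 3 * z = - Q" by (simp add: eval_nat_numeral ac_simps)
        then show ?thesis using regular Q assms
          by (intro represented_s1[of Q] represented_inverse[of "1 / Q"]) auto
      qed
    qed
  qed
  then show ?thesis by (simp add: Q_def)
qed

text \<open>Inversion reduces a value \<open>q\<^sup>-\<^sup>2\<close> to \<open>q\<^sup>2\<close>.\<close>

lemma short_root_in_P_represented:
  assumes "q \<noteq> 0" "primitive_root_of_unity 3 \<zeta>" "z \<noteq> 0" "w \<noteq> 0"
    and "{q\<^sup>2, 1 / q\<^sup>2} \<inter> {z, z * w, z ^ 2 * w} \<noteq> {}"
  shows "represented q \<zeta> z w"
proof -
  obtain v where v: "v = q\<^sup>2 \<or> v = 1 / q\<^sup>2" "v \<in> {z, z * w, z ^ 2 * w}"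
    using assms(5) by blast
  have pole: "represented q \<zeta> (1 / q\<^sup>2) y" if "y \<noteq> 0" for y
    by (rule represented_inverse)
      (use that assms short_root_pole_represented in \<open>auto simp: divide_inverse\<close>)
  show ?thesis
  proof (rule represented_short_root[OF assms(3,4) v(2)])
    show "represented q \<zeta> v y" if "y \<noteq> 0" for y
      using v(1) pole[OF that] short_root_pole_represented[OF assms(1,2) that] by blast
  qed
qed

lemma long_root_pole_represented:
  assumes "q \<noteq> 0" "primitive_root_of_unity 3 \<zeta>" "z \<noteq> 0"
  shows "represented q \<zeta> z (q\<^sup>2)"
proof -
  define Q where "Q = q\<^sup>2"
  have Q: "Q \<noteq> 0" using assms(1) by (simp add: Q_def)
  have pows: "q ^ 4 = Q ^ 2" by (simp add: Q_def flip: power_mult)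
  have powi: "q powi (-2) = 1 / Q" by (simp add: Q_def power_int_minus divide_inverse)
  have \<zeta>0: "\<zeta> \<noteq> 0" and \<zeta>3: "\<zeta> ^ 3 = 1" using assms(2) by (auto simp: primitive_root_of_unity_def)
  have \<zeta>Q: "represented q \<zeta> \<zeta> Q"
    by (rule represented_refl) (simp add: representatives_def flip: Q_def)
  have third: "represented q \<zeta> y Q" if y: "y ^ 3 = 1" "y \<noteq> 1" for y
  proof -
    consider "y = \<zeta>" | "y = 1 / \<zeta>" using cube_eq_one_cases[OF assms(2) y(1)] y(2) by auto
    then show ?thesis
    proof cases
      case 1 then show ?thesis using \<zeta>Q by simp
    next
      case 2
      then have "represented q \<zeta> (1 / y) (y ^ 3 * Q)" using \<zeta>Q y by simp
      then show ?thesis using 2 \<zeta>0 Q by (intro represented_s1[of y]) auto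
    qed
  qed
  have "represented q \<zeta> z Q"
  proof (cases "1 \<in> root_values z Q \<or> {Q, 1 / Q} \<inter> {z, z * Q, z ^ 2 * Q} \<noteq> {}")
    case True
    then show ?thesis
      using value_one_represented[OF assms Q] short_root_in_P_represented[OF assms Q]
      unfolding Q_def by blast
  next
    case False
    then have one: "1 \<notin> root_values z Q" and short: "{Q, 1 / Q} \<inter> {z, z * Q, z ^ 2 * Q} = {}"
      by auto
    have ne: "z \<noteq> 1" "Q * z \<noteq> 1" "Q * z ^ 2 \<noteq> 1" "Q * z ^ 3 \<noteq> 1" "Q ^ 2 * z ^ 3 \<noteq> 1"
      using one by (auto simp: root_values_def ac_simps)
    consider (generic) "{1, Q, 1 / Q} \<inter> {z, Q * z, Q * z ^ 2, Q * z ^ 3, Q ^ 2 * z ^ 3} = {}"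
      | (special) "\<exists>y\<in>{Q * z ^ 3, Q ^ 2 * z ^ 3}. y = Q \<or> y * Q = 1"
      using short ne Q by (auto simp: eq_divide_eq ac_simps)
    then show ?thesis
    proof cases
      case generic
      then have "tw z Q \<in> representatives q \<zeta>"
        using assms(3) unfolding representatives_def pows powi Q_def[symmetric] by blast
      then show ?thesis by (rule represented_refl)
    next
      case special
      then consider "z ^ 3 = 1" | "(z * Q) ^ 3 = 1"
        using ne Q by (auto simp: eval_nat_numeral ac_simps)
      then show ?thesis
      proof cases
        case 1 then show ?thesis using third ne by blast
      next
        case 2
        \<comment> \<open>Apply \<open>s\<^sub>2\<close> and invert: \<open>(z, Q)\<close> becomes \<open>(1/(zQ), Q)\<close>.\<close>
        have "represented q \<zeta> (1 / (z * Q)) Q"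
          by (rule third) (use 2 ne in \<open>auto simp: power_one_over ac_simps\<close>)
        then show ?thesis using Q assms
          by (intro represented_s2[of z] represented_inverse[of "z * Q"]) auto
      qed
    qed
  qed
  then show ?thesis by (simp add: Q_def)
qed

lemma long_root_in_P_represented:
  assumes "q \<noteq> 0" "primitive_root_of_unity 3 \<zeta>" "z \<noteq> 0" "w \<noteq> 0"
    and "{q\<^sup>2, 1 / q\<^sup>2} \<inter> {w, z ^ 3 * w, z ^ 3 * w ^ 2} \<noteq> {}"
  shows "represented q \<zeta> z w"
proof -
  obtain v where v: "v = q\<^sup>2 \<or> v = 1 / q\<^sup>2" "v \<in> {w, z ^ 3 * w, z ^ 3 * w ^ 2}"
    using assms(5) by blast
  have pole: "represented q \<zeta> x (1 / q\<^sup>2)" if "x \<noteq> 0" for x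
    by (rule represented_inverse)
      (use that assms long_root_pole_represented in \<open>auto simp: divide_inverse\<close>)
  show ?thesis
  proof (rule represented_long_root[OF assms(3,4) v(2)])
    show "represented q \<zeta> x v" if "x \<noteq> 0" for x
      using v(1) pole[OF that] long_root_pole_represented[OF assms(1,2) that] by blast
  qed
qed

section \<open>The classification\<close>

theorem theorem22:
  fixes q \<zeta> :: complex and t :: "weight \<Rightarrow> complex"
  assumes "q \<noteq> 0"
    and "\<forall>l::nat. l \<le> 6 \<longrightarrow> \<not> primitive_root_of_unity l (q ^ 2)"
    and "primitive_root_of_unity 3 \<zeta>"
    and "t \<in> T"
    and "Zset t \<union> Pset q t \<noteq> {}"
  shows "\<exists>u. t \<in> W_orbit u \<and>
    (u \<in> {tw 1 1, tw 1 (-1), tw \<zeta> 1, tw 1 (q ^ 2), tw 1 q, tw 1 (- q),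
           tw (q ^ 2) 1, tw q 1, tw (- q) 1,
           tw (q ^ 2) (- (q powi (-2))), tw \<zeta> (q ^ 2), tw (q ^ 2) (q ^ 2)}
     \<or> (\<exists>r. r ^ 3 = q ^ 2 \<and> u = tw r 1)
     \<or> (\<exists>z. z \<noteq> 0 \<and> z \<notin> {1, -1, q ^ 2, q powi (-2), q, - q, q powi (-1), - (q powi (-1))}
            \<and> u = tw 1 z)
     \<or> (\<exists>z. z \<noteq> 0 \<and> z \<notin> {1, -1, q ^ 2, q powi (-2), q, - q, q powi (-1), - (q powi (-1))}
            \<and> z ^ 3 \<noteq> 1 \<and> z ^ 3 \<notin> {q ^ 2, q powi (-2)}
            \<and> u = tw z 1)
     \<or> (\<exists>z. z \<noteq> 0
            \<and> {1, q ^ 2, q powi (-2)} \<inter> {z, q ^ 2 * z, q ^ 4 * z, q ^ 6 * z, q ^ 6 * z ^ 2} = {}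
            \<and> u = tw (q ^ 2) z)
     \<or> (\<exists>z. z \<noteq> 0
            \<and> {1, q ^ 2, q powi (-2)} \<inter>
              {z, q ^ 2 * z, q ^ 2 * z ^ 2, q ^ 2 * z ^ 3, q ^ 4 * z ^ 3} = {}
            \<and> u = tw z (q ^ 2)))"
proof -
  define z w where "z = t \<alpha>1" and "w = t \<alpha>2"
  have nz: "z \<noteq> 0" "w \<noteq> 0" and t: "t = tw z w"
    unfolding z_def w_def using T_eq_tw[OF assms(4)] by blast+
  from assms(5) have "\<exists>v\<in>tw z w ` Rpos. v = 1 \<or> v \<in> {q\<^sup>2, 1 / q\<^sup>2}"
    unfolding t Zset_def Pset_def by (auto simp: power_int_minus divide_inverse)
  then obtain v where v: "v \<in> root_values z w" "v = 1 \<or> v \<in> {q\<^sup>2, 1 / q\<^sup>2}"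
    unfolding tw_image_Rpos by blast
  then consider "v = 1" | "v \<in> {q\<^sup>2, 1 / q\<^sup>2}" "v \<in> {z, z * w, z ^ 2 * w}"
    | "v \<in> {q\<^sup>2, 1 / q\<^sup>2}" "v \<in> {w, z ^ 3 * w, z ^ 3 * w ^ 2}"
    unfolding root_values_def by blast
  then have "represented q \<zeta> z w"
  proof cases
    case 1 then show ?thesis using v value_one_represented[OF assms(1,3) nz] by simp
  next
    case 2 then show ?thesis by (intro short_root_in_P_represented[OF assms(1,3) nz]) blast
  next
    case 3 then show ?thesis by (intro long_root_in_P_represented[OF assms(1,3) nz]) blast
  qed
  then obtain u where "u \<in> representatives q \<zeta>" "t \<in> W_orbit u"
    unfolding represented_def t by blast
  then show ?thesis unfolding representatives_def mem_Collect_eq by (intro exI[of _ u] conjI)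
qed

end
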